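(* Let $k\in\{2,3\}$, and let $\phi_1=\frac{a_1}{\Delta x}$, $\phi_2=\frac{a_2}{\Delta y}$, $\phi_3=\frac{a_3}{\Delta z}$, $\phi_*=\max\{\phi_1,\phi_2,\phi_3\}$, $\psi=\phi_1+\phi_2+\phi_3+2\phi_*$, $\mu_1=\frac{\phi_1}{\psi}$, $\mu_2=\frac{\phi_2}{\psi}$, $\mu_3=\frac{\phi_3}{\psi}$, $\omega=\frac{\phi_*}{\psi}$. Then the 3D convex decomposition $$\begin{aligned}\bar u_{ij\ell}={}&\frac{\mu_1}{2}\sum_{q=1}^Q\sum_{r=1}^Q\omega_q^{\tt G}\omega_r^{\tt G}\left[u_{i-\frac12,q,r}^{+}+u_{i+\frac12,q,r}^{-}\right]+\frac{\mu_2}{2}\sum_{q=1}^Q\sum_{r=1}^Q\omega_q^{\tt G}\omega_r^{\tt G}\left[u_{r,j-\frac12,q}^{+}+u_{r,j+\frac12,q}^{-}\right]\\&+\frac{\mu_3}{2}\sum_{q=1}^Q\sum_{r=1}^Q\omega_q^{\tt G}\omega_r^{\tt G}\left[u_{q,r,\ell-\frac12}^{+}+u_{q,r,\ell+\frac12}^{-}\right]+\frac{\omega}{2}\sum_s p_{ij\ell}(\hat x_s,\hat y_s,\hat z_s),\end{aligned}$$ where $(\hat x_s,\hat y_s,\hat z_s)$ runs over the following four internal nodes (counted with multiplicity if some coincide): $$\begin{cases}\left(x_i,\ y_j\pm\frac{\Delta y}{\sqrt6}\sqrt{\frac{\phi_*-\phi_2}{\phi_*}},\ z_\ell\right)\ \text{and}\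 \left(x_i,\ y_j,\ z_\ell\pm\frac{\Delta z}{\sqrt6}\sqrt{\frac{\phi_*-\phi_3}{\phi_*}}\right),&\text{if }\phi_1=\phi_*,\\[2mm]\left(x_i,\ y_j,\ z_\ell\pm\frac{\Delta z}{\sqrt6}\sqrt{\frac{\phi_*-\phi_3}{\phi_*}}\right)\ \text{and}\ \left(x_i\pm\frac{\Delta x}{\sqrt6}\sqrt{\frac{\phi_*-\phi_1}{\phi_*}},\ y_j,\ z_\ell\right),&\text{if }\phi_2=\phi_*,\\[2mm]\left(x_i\pm\frac{\Delta x}{\sqrt6}\sqrt{\frac{\phi_*-\phi_1}{\phi_*}},\ y_j,\ z_\ell\right)\ \text{and}\ \left(x_i,\ y_j\pm\frac{\Delta y}{\sqrt6}\sqrt{\frac{\phi_*-\phi_2}{\phi_*}},\ z_\ell\right),&\text{if }\phi_3=\phi_*,\end{cases}$$ is optimal among all feasible 3D convex decompositions for $\mathbb P^k$; that is, it is feasible for $\mathbb P^k$ and, among all 3D convex decompositions feasible for $\mathbb P^k$, it attains the maximum of $$\min\left\{\frac{\omega_1^-\Delta x}{a_1},\frac{\omega_1^+\Delta x}{a_1},\frac{\omega_2^-\Delta y}{a_2},\frac{\omega_2^+\Delta y}{a_2},\frac{\omega_3^-\Delta z}{a_3},\frac{\omega_3^+\Delta z}{a_3}\right\}$$ (for the displayed decomposition, $\omega_1^\pm=\mu_1/2$, $\omega_2^\pm=\mu_2/2$, $\omega_3^\pm=\mu_3/2$).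
   Context: $\mathbb P^k$ is the space of polynomials in three variables of total degree at most $k$. $\Omega_{ij\ell}=[x_{i-\frac12},x_{i+\frac12}]\times[y_{j-\frac12},y_{j+\frac12}]\times[z_{\ell-\frac12},z_{\ell+\frac12}]$ is a cuboid cell with center $(x_i,y_j,z_\ell)$ and side lengths $\Delta x,\Delta y,\Delta z>0$; $a_1,a_2,a_3>0$ are given constants (maximum characteristic speeds in the $x$-, $y$- and $z$-directions). For $p_{ij\ell}\in\mathbb P^k$, $\bar u_{ij\ell}$ is the average of $p_{ij\ell}$ over $\Omega_{ij\ell}$. $\{x_{i,q}^{\tt G}\}_{q=1}^Q$, $\{y_{j,q}^{\tt G}\}_{q=1}^Q$, $\{z_{\ell,q}^{\tt G}\}_{q=1}^Q$ are the $Q$-point Gauss quadrature nodes in the three coordinate intervals of the cell, with positive weights $\omega_q^{\tt G}$ normalized by $\sum_{q=1}^Q\omega_q^{\tt G}=1$; $Q$ is fixed and such that the rule is exact for univariate polynomials of degree at most $k$ (typically $Q=k+1$). Set $$u_{i\pm\frac12,q,r}^{\mp}=p_{ij\ell}(x_{i\pm\frac12},y_{j,q}^{\tt G},z_{\ell,r}^{\tt G}),\quad u_{r,j\pm\frac12,q}^{\mp}=p_{ij\ell}(x_{i,r}^{\tt G},y_{j\pm\frac12},z_{\ell,q}^{\tt G}),\quad u_{q,r,\ell\pm\frac12}^{\mp}=p_{ij\ell}(x_{i,q}^{\tt G},y_{j,r}^{\tt G},z_{\ell\pm\frac12}).$$ A 3D convex decomposition $$\begin{aligned}\bar u_{ij\ell}=\sum_{q=1}^Q\sum_{r=1}^Q\omega_q^{\tt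 G}\omega_r^{\tt G}\Big[&\omega_1^-u_{i-\frac12,q,r}^++\omega_1^+u_{i+\frac12,q,r}^-+\omega_2^-u_{r,j-\frac12,q}^++\omega_2^+u_{r,j+\frac12,q}^-\\&+\omega_3^-u_{q,r,\ell-\frac12}^++\omega_3^+u_{q,r,\ell+\frac12}^-\Big]+\sum_{s=1}^S\omega_s\,p_{ij\ell}(x^{(s)},y^{(s)},z^{(s)})\end{aligned}$$ is called feasible for $\mathbb P^k$ if (i) it holds exactly for all $p_{ij\ell}\in\mathbb P^k$; (ii) the weights $\omega_1^\pm,\omega_2^\pm,\omega_3^\pm,\omega_s$ are all positive (they sum to one); (iii) all internal nodes $(x^{(s)},y^{(s)},z^{(s)})$ lie in $\Omega_{ij\ell}$. The number $S$ of internal nodes is arbitrary. A feasible decomposition is called optimal if it yields the mildest bound-preserving CFL condition, which for a feasible decomposition is $\Delta t\le c_0\min\left\{\frac{\omega_1^\pm\Delta x}{a_1},\frac{\omega_2^\pm\Delta y}{a_2},\frac{\omega_3^\pm\Delta z}{a_3}\right\}$ (with $c_0>0$ a fixed constant), i.e. it maximizes this minimum over all feasible decompositions. If $\phi_*$ is attained by more than one $\phi_r$, the applicable cases of the node list give the same nodes with multiplicity. *)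

theory Defs
  imports "HOL-Analysis.Analysis" "HOL-Computational_Algebra.Polynomial"
begin

type_synonym point3 = "real \<times> real \<times> real"

definition polys3 :: "nat \<Rightarrow> (point3 \<Rightarrow> real) set" where
  "polys3 k = {p. \<exists>c :: nat \<Rightarrow> nat \<Rightarrow> nat \<Rightarrow> real. \<forall>x y z.
     p (x, y, z) = (\<Sum>a\<le>k. \<Sum>b\<le>k - a. \<Sum>d\<le>k - a - b. c a b d * x ^ a * y ^ b * z ^ d)}"

record cell3 =
  xc :: real
  yc :: real
  zc :: real
  dx :: real
  dy :: real
  dz :: real

definition cell_set :: "cell3 \<Rightarrow> point3 set" where
  "cell_set C = cbox (xc C - dx C / 2, yc C - dy C / 2, zc C - dz C / 2)
                     (xc C + dx C / 2, yc C + dy C / 2, zc C + dz C / 2)"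

definition cell_average :: "cell3 \<Rightarrow> (point3 \<Rightarrow> real) \<Rightarrow> real" where
  "cell_average C p = integral (cell_set C) p / (dx C * dy C * dz C)"

text \<open>Exactness up to degree \<open>n\<close> on \<open>[a, b]\<close>, for weights normalised by the interval length.\<close>

definition quadrature_exact ::
  "real \<Rightarrow> real \<Rightarrow> nat \<Rightarrow> (nat \<Rightarrow> real) \<Rightarrow> (nat \<Rightarrow> real) \<Rightarrow> nat \<Rightarrow> bool" where
  "quadrature_exact a b Q x w n \<longleftrightarrow>
     (\<forall>f :: real poly. degree f \<le> n \<longrightarrow>
        (\<Sum>q=1..Q. w q * poly f (x q)) = integral {a..b} (poly f) / (b - a))"

text \<open>The \<open>Q\<close>-point Gauss(-Legendre) rule is the \<open>Q\<close>-point rule of maximal degree of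
  exactness \<open>2 Q - 1\<close>; this determines nodes and weights up to their numbering.\<close>

definition gauss_rule ::
  "real \<Rightarrow> real \<Rightarrow> nat \<Rightarrow> (nat \<Rightarrow> real) \<Rightarrow> (nat \<Rightarrow> real) \<Rightarrow> bool" where
  "gauss_rule a b Q x w \<longleftrightarrow>
     1 \<le> Q \<and> inj_on x {1..Q} \<and> x ` {1..Q} \<subseteq> {a..b} \<and>
     (\<forall>q\<in>{1..Q}. 0 < w q) \<and> (\<Sum>q=1..Q. w q) = 1 \<and>
     quadrature_exact a b Q x w (2 * Q - 1)"

text \<open>Number of points, nodes in the three coordinate intervals of a cell, common weights.\<close>

record gauss3 =
  npts :: nat
  gx :: "nat \<Rightarrow> real"
  gy :: "nat \<Rightarrow> real"
  gz :: "nat \<Rightarrow> real"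
  gw :: "nat \<Rightarrow> real"

definition is_gauss3 :: "cell3 \<Rightarrow> gauss3 \<Rightarrow> bool" where
  "is_gauss3 C G \<longleftrightarrow>
     gauss_rule (xc C - dx C / 2) (xc C + dx C / 2) (npts G) (gx G) (gw G) \<and>
     gauss_rule (yc C - dy C / 2) (yc C + dy C / 2) (npts G) (gy G) (gw G) \<and>
     gauss_rule (zc C - dz C / 2) (zc C + dz C / 2) (npts G) (gz G) (gw G)"

definition gauss3_exact :: "cell3 \<Rightarrow> gauss3 \<Rightarrow> nat \<Rightarrow> bool" where
  "gauss3_exact C G k \<longleftrightarrow>
     quadrature_exact (xc C - dx C / 2) (xc C + dx C / 2) (npts G) (gx G) (gw G) k \<and>
     quadrature_exact (yc C - dy C / 2) (yc C + dy C / 2) (npts G) (gy G) (gw G) k \<and>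
     quadrature_exact (zc C - dz C / 2) (zc C + dz C / 2) (npts G) (gz G) (gw G) k"

text \<open>The data of a decomposition: the weights \<open>\<omega>\<^sub>1\<^sup>-, \<omega>\<^sub>1\<^sup>+, \<dots>, \<omega>\<^sub>3\<^sup>+\<close> of the six
  faces, and the internal nodes with their weights. The latter form a list, so that nodes
  may repeat; its length is the number \<open>S\<close> of internal nodes.\<close>

record decomp3 =
  w1m :: real
  w1p :: real
  w2m :: real
  w2p :: real
  w3m :: real
  w3p :: real
  internal :: "(real \<times> point3) list"

definition decomp_value :: "cell3 \<Rightarrow> gauss3 \<Rightarrow> decomp3 \<Rightarrow> (point3 \<Rightarrow> real) \<Rightarrow> real" where
  "decomp_value C G D p =
     (\<Sum>q=1..npts G. \<Sum>r=1..npts G. gw G q * gw G r *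
        (w1m D * p (xc C - dx C / 2, gy G q, gz G r) +
         w1p D * p (xc C + dx C / 2, gy G q, gz G r) +
         w2m D * p (gx G r, yc C - dy C / 2, gz G q) +
         w2p D * p (gx G r, yc C + dy C / 2, gz G q) +
         w3m D * p (gx G q, gy G r, zc C - dz C / 2) +
         w3p D * p (gx G q, gy G r, zc C + dz C / 2)))
     + (\<Sum>(w, v)\<leftarrow>internal D. w * p v)"

definition feasible :: "nat \<Rightarrow> cell3 \<Rightarrow> gauss3 \<Rightarrow> decomp3 \<Rightarrow> bool" where
  "feasible k C G D \<longleftrightarrow>
     (\<forall>p\<in>polys3 k. cell_average C p = decomp_value C G D p) \<and>
     0 < w1m D \<and> 0 < w1p D \<and> 0 < w2m D \<and> 0 < w2p D \<and> 0 < w3m D \<and> 0 < w3p D \<and>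
     (\<forall>(w, v)\<in>set (internal D). 0 < w) \<and>
     w1m D + w1p D + w2m D + w2p D + w3m D + w3p D + (\<Sum>(w, v)\<leftarrow>internal D. w) = 1 \<and>
     (\<forall>(w, v)\<in>set (internal D). v \<in> cell_set C)"

text \<open>The CFL condition of a feasible decomposition is
  \<open>\<Delta>t \<le> c\<^sub>0 * cfl_bound C a1 a2 a3 D\<close> with a fixed constant \<open>c\<^sub>0 > 0\<close>.\<close>

definition cfl_bound :: "cell3 \<Rightarrow> real \<Rightarrow> real \<Rightarrow> real \<Rightarrow> decomp3 \<Rightarrow> real" where
  "cfl_bound C a1 a2 a3 D =
     Min {w1m D * dx C / a1, w1p D * dx C / a1,
          w2m D * dy C / a2, w2p D * dy C / a2,
          w3m D * dz C / a3, w3p D * dz C / a3}"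

definition optimal ::
  "nat \<Rightarrow> cell3 \<Rightarrow> gauss3 \<Rightarrow> real \<Rightarrow> real \<Rightarrow> real \<Rightarrow> decomp3 \<Rightarrow> bool" where
  "optimal k C G a1 a2 a3 D \<longleftrightarrow>
     feasible k C G D \<and>
     (\<forall>D'. feasible k C G D' \<longrightarrow> cfl_bound C a1 a2 a3 D' \<le> cfl_bound C a1 a2 a3 D)"

end

theory Submission imports Defs begin

text \<open>A feasible decomposition is exact for the nonnegative polynomial \<open>(x - x\<^sub>i)\<^sup>2\<close>. Discarding the
  internal nodes there and comparing with the average \<open>\<Delta>x\<^sup>2 / 12\<close> gives
  \<open>3 (\<omega>\<^sub>1\<^sup>- + \<omega>\<^sub>1\<^sup>+) + (\<omega>\<^sub>2\<^sup>- + \<omega>\<^sub>2\<^sup>+) + (\<omega>\<^sub>3\<^sup>- + \<omega>\<^sub>3\<^sup>+) \<le> 1\<close>, and similarly for \<open>y\<close> and \<open>z\<close>. In the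
  direction of the largest \<open>\<phi>\<close> this bounds the minimum by \<open>1 / (2 \<psi>)\<close>, which the displayed
  decomposition attains. For its exactness, up to degree 3 every symmetric average of \<open>x\<^sup>n\<close> about
  \<open>c\<close> is \<open>c\<^sup>n\<close> plus a multiple of the second Taylor coefficient, and these coefficients in two
  different variables cannot both be nonzero in a monomial of total degree at most 3; hence
  exactness reduces to matching one scalar equation per direction.\<close>

section \<open>One-dimensional averages of powers\<close>

definition mean :: "real \<Rightarrow> real \<Rightarrow> (real \<Rightarrow> real) \<Rightarrow> real" where
  "mean c h f = integral {c - h / 2..c + h / 2} f / h"

text \<open>The coefficient of \<open>e ^ 2\<close> in \<open>(c + e) ^ n\<close>. For
  \<open>n < 2\<close> the binomial coefficient is 0, so the truncated exponent \<open>n - 2\<close>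
  does no harm.\<close>

definition taylor2 :: "nat \<Rightarrow> real \<Rightarrow> real" where
  "taylor2 n c = real (n choose 2) * c ^ (n - 2)"

lemma integral_power_real:
  fixes a b :: real
  assumes "a \<le> b"
  shows "integral {a..b} (\<lambda>x. x ^ n) = (b ^ Suc n - a ^ Suc n) / real (Suc n)"
proof -
  have "((\<lambda>x. x ^ n) has_integral (b ^ Suc n / real (Suc n) - a ^ Suc n / real (Suc n))) {a..b}"
  proof (rule fundamental_theorem_of_calculus[OF assms])
    fix x assume "x \<in> {a..b}"
    have "((\<lambda>x. x ^ Suc n / real (Suc n)) has_real_derivative x ^ n) (at x within {a..b})"
      by (rule derivative_eq_intros refl | simp)+
    then show "((\<lambda>x. x ^ Suc n / real (Suc n)) has_vector_derivative x ^ n) (at x within {a..b})"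
      by (simp add: has_real_derivative_iff_has_vector_derivative)
  qed
  then show ?thesis by (simp add: integral_unique diff_divide_distrib)
qed

lemma nat_le_3_cases: "n \<le> 3 \<Longrightarrow> n = 0 \<or> n = 1 \<or> n = 2 \<or> n = (3::nat)"
  by linarith

text \<open>Expand \<open>x ^ n\<close> about the midpoint \<open>c\<close>: odd moments vanish, the
  second moment is \<open>h ^ 2 / 12\<close>, and a fourth-order term would need
  \<open>n > 3\<close>.\<close>

lemma mean_power:
  assumes "0 < h" "n \<le> 3"
  shows "mean c h (\<lambda>x. x ^ n) = c ^ n + h\<^sup>2 / 12 * taylor2 n c"
  using nat_le_3_cases[OF assms(2)] assms(1)
  by (auto simp: mean_def taylor2_def integral_power_real numeral_eq_Suc field_simps)

lemma mean_monom:
  assumes "0 < h" "n \<le> 3"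
  shows "mean c h (poly (monom t n)) = t * (c ^ n + h\<^sup>2 / 12 * taylor2 n c)"
proof -
  have "poly (monom t n) = (\<lambda>x. t * x ^ n)" by (simp add: fun_eq_iff poly_monom)
  then have "mean c h (poly (monom t n)) = t * mean c h (\<lambda>x. x ^ n)" by (simp add: mean_def)
  then show ?thesis using mean_power[OF assms] by simp
qed

text \<open>Odd powers of \<open>e\<close> cancel, and for \<open>n \<le> 3\<close> the only even
  ones are \<open>e ^ 0\<close> and \<open>e ^ 2\<close>.\<close>

lemma symmetric_pair_power:
  fixes c e :: real
  assumes "n \<le> 3"
  shows "(c - e) ^ n + (c + e) ^ n = 2 * (c ^ n + e\<^sup>2 * taylor2 n c)"
  using nat_le_3_cases[OF assms]
  by (auto simp: taylor2_def numeral_eq_Suc algebra_simps)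

text \<open>Both factors can be nonzero only if \<open>a\<close> and \<open>b\<close> are at least
  2, that is, from total degree 4 on. This is where the restriction to degree at most 3
  enters.\<close>

lemma taylor2_mult_eq_0: "a + b \<le> 3 \<Longrightarrow> taylor2 a x * taylor2 b y = 0"
  by (auto simp: taylor2_def binomial_eq_0_iff)

lemma mean_one: "0 < h \<Longrightarrow> mean c h (\<lambda>x. 1) = 1"
  by (simp add: mean_def)

lemma mean_centred_square: "0 < h \<Longrightarrow> mean c h (\<lambda>x. (x - c)\<^sup>2) = h\<^sup>2 / 12"
proof -
  assume h: "0 < h"
  have "((\<lambda>x. (x - c)\<^sup>2) has_integral (c + h / 2 - c) ^ 3 / 3 - (c - h / 2 - c) ^ 3 / 3)
      {c - h / 2..c + h / 2}"
  proof (rule fundamental_theorem_of_calculus)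
    fix x
    have "((\<lambda>x. (x - c) ^ 3 / 3) has_real_derivative (x - c)\<^sup>2) (at x within {c - h / 2..c + h / 2})"
      by (rule derivative_eq_intros refl | simp)+
    then show "((\<lambda>x. (x - c) ^ 3 / 3) has_vector_derivative (x - c)\<^sup>2)
        (at x within {c - h / 2..c + h / 2})"
      by (simp add: has_real_derivative_iff_has_vector_derivative)
  qed (use h in simp)
  with h show ?thesis
    by (simp add: mean_def integral_unique power2_eq_square power3_eq_cube field_simps)
qed

lemma quadrature_exact_mean:
  assumes "quadrature_exact (c - h / 2) (c + h / 2) Q x w k" "degree F \<le> k"
  shows "(\<Sum>q=1..Q. w q * poly F (x q)) = mean c h (poly F)"
  using assms by (simp add: quadrature_exact_def mean_def)

section \<open>Products of univariate polynomials\<close>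

text \<open>Covers both kinds of test function: the monomials that establish exactness and the
  centred squares that bound the weights. Factors of type \<open>real poly\<close> fit the form of
  \<open>quadrature_exact\<close>.\<close>

definition separable :: "real poly \<Rightarrow> real poly \<Rightarrow> real poly \<Rightarrow> point3 \<Rightarrow> real" where
  "separable F G H = (\<lambda>(x, y, z). poly F x * poly G y * poly H z)"

lemma separable_apply [simp]: "separable F G H (x, y, z) = poly F x * poly G y * poly H z"
  by (simp add: separable_def)

lemma continuous_on_separable: "continuous_on S (separable F G H)"
  unfolding separable_def case_prod_unfold by (intro continuous_intros)

text \<open>Fubini for continuous integrands, applied twice because a point is a nested
  pair.\<close>

lemma cell_average_separable:
  "cell_average C (separable F G H) =
     mean (xc C) (dx C) (poly F) * mean (yc C) (dy C) (poly G) * mean (zc C) (dz C) (poly H)"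
proof -
  have inner: "integral (cbox (c, e) (d, f)) (\<lambda>v. separable F G H (x, v)) =
      poly F x * (integral {c..d} (poly G) * integral {e..f} (poly H))" for x c d e f
  proof -
    have "continuous_on (cbox (c, e) (d, f)) (\<lambda>v. separable F G H (x, v))"
      unfolding separable_def case_prod_unfold by (intro continuous_intros)
    from integral_prod_continuous[OF this] show ?thesis by (simp add: mult.assoc)
  qed
  have "integral (cell_set C) (separable F G H) =
      integral {xc C - dx C / 2..xc C + dx C / 2} (poly F) *
      (integral {yc C - dy C / 2..yc C + dy C / 2} (poly G) *
       integral {zc C - dz C / 2..zc C + dz C / 2} (poly H))"
    unfolding cell_set_def integral_prod_continuous[OF continuous_on_separable] inner by simp
  then show ?thesis by (simp add: cell_average_def mean_def)
qed

lemma sum_mult_sum3: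
  fixes w :: "nat \<Rightarrow> real"
  shows "(\<Sum>q=1..Q. \<Sum>r=1..Q. w q * w r * (c * f q * g r)) =
    c * (\<Sum>q=1..Q. w q * f q) * (\<Sum>r=1..Q. w r * g r)"
  by (simp add: sum_distrib_left sum_distrib_right mult_ac)

text \<open>On each face the tensor-product rule factors into two univariate rules; their exactness
  replaces the Gauss sums by means, so the nodes disappear.\<close>

lemma decomp_value_separable:
  assumes ex: "gauss3_exact C G k"
    and deg: "degree F1 \<le> k" "degree F2 \<le> k" "degree F3 \<le> k"
  defines "A \<equiv> mean (xc C) (dx C) (poly F1)"
    and "B \<equiv> mean (yc C) (dy C) (poly F2)"
    and "E \<equiv> mean (zc C) (dz C) (poly F3)"
  shows "decomp_value C G D (separable F1 F2 F3) =
    (w1m D * poly F1 (xc C - dx C / 2) + w1p D * poly F1 (xc C + dx C / 2)) * B * E +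
    (w2m D * poly F2 (yc C - dy C / 2) + w2p D * poly F2 (yc C + dy C / 2)) * E * A +
    (w3m D * poly F3 (zc C - dz C / 2) + w3p D * poly F3 (zc C + dz C / 2)) * A * B +
    (\<Sum>(w, v)\<leftarrow>internal D. w * separable F1 F2 F3 v)"
proof -
  have A: "A = (\<Sum>q=1..npts G. gw G q * poly F1 (gx G q))"
    and B: "B = (\<Sum>q=1..npts G. gw G q * poly F2 (gy G q))"
    and E: "E = (\<Sum>q=1..npts G. gw G q * poly F3 (gz G q))"
    using ex deg unfolding gauss3_exact_def A_def B_def E_def
    by (blast intro: quadrature_exact_mean[symmetric])+
  let ?X = "w1m D * poly F1 (xc C - dx C / 2) + w1p D * poly F1 (xc C + dx C / 2)"
  let ?Y = "w2m D * poly F2 (yc C - dy C / 2) + w2p D * poly F2 (yc C + dy C / 2)"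
  let ?Z = "w3m D * poly F3 (zc C - dz C / 2) + w3p D * poly F3 (zc C + dz C / 2)"
  \<comment> \<open>On the y faces \<open>q\<close> indexes z nodes and \<open>r\<close> x nodes;
    the factors are ordered so that \<open>sum_mult_sum3\<close> applies to each of the three
    terms.\<close>
  have "decomp_value C G D (separable F1 F2 F3) =
    (\<Sum>q=1..npts G. \<Sum>r=1..npts G. gw G q * gw G r * (?X * poly F2 (gy G q) * poly F3 (gz G r)) +
      gw G q * gw G r * (?Y * poly F3 (gz G q) * poly F1 (gx G r)) +
      gw G q * gw G r * (?Z * poly F1 (gx G q) * poly F2 (gy G r))) +
    (\<Sum>(w, v)\<leftarrow>internal D. w * separable F1 F2 F3 v)"
    unfolding decomp_value_def
    by (intro arg_cong2[where f = "(+)"] sum.cong refl) (simp add: algebra_simps)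
  then show ?thesis
    by (simp only: sum.distrib sum_mult_sum3 A B E)
qed

section \<open>Exactness, reduced to monomials\<close>

lemma cell_average_sum:
  assumes "\<And>i. i \<in> I \<Longrightarrow> continuous_on UNIV (f i)"
  shows "cell_average C (\<lambda>v. \<Sum>i\<in>I. f i v) = (\<Sum>i\<in>I. cell_average C (f i))"
proof (cases "finite I")
  case True
  have "f i integrable_on cell_set C" if "i \<in> I" for i
    unfolding cell_set_def
    by (rule integrable_continuous, rule continuous_on_subset[OF assms[OF that]]) simp
  with True show ?thesis
    by (simp add: cell_average_def integral_sum sum_divide_distrib)
qed (simp add: cell_average_def)

lemma decomp_value_sum:
  "decomp_value C G D (\<lambda>v. \<Sum>i\<in>I. f i v) = (\<Sum>i\<in>I. decomp_value C G D (f i))"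
proof (induction I rule: infinite_finite_induct)
  case (insert i I)
  have add: "decomp_value C G D (\<lambda>v. g v + h v) = decomp_value C G D g + decomp_value C G D h"
    for g h
    by (simp add: decomp_value_def algebra_simps sum.distrib case_prod_unfold sum_list_addf)
  show ?case by (simp add: insert add)
qed (simp_all add: decomp_value_def case_prod_unfold)

text \<open>Both sides are linear in \<open>p\<close>, so monomials suffice. The scalar
  \<open>t\<close> sits in the first factor, since \<open>separable\<close> has no coefficient of
  its own.\<close>

lemma polys3_exactI:
  assumes "\<And>a b d t. a + b + d \<le> k \<Longrightarrow>
      cell_average C (separable (monom t a) (monom 1 b) (monom 1 d)) =
      decomp_value C G D (separable (monom t a) (monom 1 b) (monom 1 d))"
    and "p \<in> polys3 k"
  shows "cell_average C p = decomp_value C G D p"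
proof -
  obtain c where c: "\<And>x y z. p (x, y, z) =
      (\<Sum>a\<le>k. \<Sum>b\<le>k - a. \<Sum>d\<le>k - a - b. c a b d * x ^ a * y ^ b * z ^ d)"
    using assms(2) by (auto simp: polys3_def)
  define m where "m a b d = separable (monom (c a b d) a) (monom 1 b) (monom 1 d)" for a b d
  have p: "p = (\<lambda>v. \<Sum>a\<le>k. \<Sum>b\<le>k - a. \<Sum>d\<le>k - a - b. m a b d v)"
    by (auto simp: c m_def poly_monom)
  have "cell_average C p = (\<Sum>a\<le>k. \<Sum>b\<le>k - a. \<Sum>d\<le>k - a - b. cell_average C (m a b d))"
    unfolding p
    by (simp add: cell_average_sum m_def continuous_on_sum continuous_on_separable)
  also have "\<dots> = (\<Sum>a\<le>k. \<Sum>b\<le>k - a. \<Sum>d\<le>k - a - b. decomp_value C G D (m a b d))"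
    by (intro sum.cong refl) (auto simp: m_def intro!: assms(1))
  also have "\<dots> = decomp_value C G D p"
    unfolding p by (simp add: decomp_value_sum)
  finally show ?thesis .
qed


text \<open>All three node pairs appear in the hypothesis on the internal nodes, so that the cases
  \<open>\<phi>\<^sub>r = \<phi>\<^sub>*\<close> are treated at once: the pair of direction \<open>r\<close> has offset 0 there and is cancelled by
  the subtracted value at the centre.\<close>

lemma cell_average_eq_decomp_value:
  assumes "k \<le> 3" and pos: "0 < dx C" "0 < dy C" "0 < dz C" and ex: "gauss3_exact C G k"
    and w: "w1m D = \<mu>1 / 2" "w1p D = \<mu>1 / 2" "w2m D = \<mu>2 / 2" "w2p D = \<mu>2 / 2"
      "w3m D = \<mu>3 / 2" "w3p D = \<mu>3 / 2"
    and sum1: "\<mu>1 + \<mu>2 + \<mu>3 + 2 * \<omega> = 1"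
    and h: "\<omega> * hx\<^sup>2 = (dx C)\<^sup>2 / 6 * (\<omega> - \<mu>1)"
      "\<omega> * hy\<^sup>2 = (dy C)\<^sup>2 / 6 * (\<omega> - \<mu>2)"
      "\<omega> * hz\<^sup>2 = (dz C)\<^sup>2 / 6 * (\<omega> - \<mu>3)"
    and int: "\<And>p :: point3 \<Rightarrow> real. (\<Sum>(w, v)\<leftarrow>internal D. w * p v) = \<omega> / 2 *
      (p (xc C - hx, yc C, zc C) + p (xc C + hx, yc C, zc C) +
       p (xc C, yc C - hy, zc C) + p (xc C, yc C + hy, zc C) +
       p (xc C, yc C, zc C - hz) + p (xc C, yc C, zc C + hz) - 2 * p (xc C, yc C, zc C))"
    and "p \<in> polys3 k"
  shows "cell_average C p = decomp_value C G D p"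
proof (rule polys3_exactI[OF _ \<open>p \<in> polys3 k\<close>])
  fix a b d :: nat and c :: real
  assume abd: "a + b + d \<le> k"
  define X where "X = xc C ^ a"
  define Y where "Y = yc C ^ b"
  define Z where "Z = zc C ^ d"
  define s where "s = taylor2 a (xc C)"
  define t where "t = taylor2 b (yc C)"
  define u where "u = taylor2 d (zc C)"
  define A1 where "A1 = (dx C)\<^sup>2 / 12"
  define A2 where "A2 = (dy C)\<^sup>2 / 12"
  define A3 where "A3 = (dz C)\<^sup>2 / 12"
  have le: "a \<le> 3" "b \<le> 3" "d \<le> 3" using abd \<open>k \<le> 3\<close> by auto
  have deg: "degree (monom c a) \<le> k" "degree (monom (1::real) b) \<le> k" "degree (monom (1::real) d) \<le> k"
    using abd by (auto intro: degree_monom_le[THEN order_trans])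
  have "s * t = 0" "s * u = 0" "t * u = 0"
    unfolding s_def t_def u_def using abd \<open>k \<le> 3\<close> by (intro taylor2_mult_eq_0; linarith)+
  \<comment> \<open>Every mixed term of the expansion contains one of the vanishing products
    \<open>s * t\<close>, \<open>s * u\<close>, \<open>t * u\<close>.\<close>
  then have prod3: "(X + x * s) * (Y + y * t) * (Z + z * u) =
      X * Y * Z + x * (s * Y * Z) + y * (X * t * Z) + z * (X * Y * u)" for x y z
    by algebra
  have m: "mean (xc C) (dx C) (poly (monom c a)) = c * (X + A1 * s)"
    "mean (yc C) (dy C) (poly (monom 1 b)) = Y + A2 * t"
    "mean (zc C) (dz C) (poly (monom 1 d)) = Z + A3 * u"
    using mean_monom[OF pos(1) le(1)] mean_monom[OF pos(2) le(2)] mean_monom[OF pos(3) le(3)]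
    by (simp_all add: X_def Y_def Z_def A1_def A2_def A3_def s_def t_def u_def)
  have pair: "(xc C - e) ^ a + (xc C + e) ^ a = 2 * (X + e\<^sup>2 * s)"
    "(yc C - e) ^ b + (yc C + e) ^ b = 2 * (Y + e\<^sup>2 * t)"
    "(zc C - e) ^ d + (zc C + e) ^ d = 2 * (Z + e\<^sup>2 * u)" for e
    unfolding X_def Y_def Z_def s_def t_def u_def by (intro symmetric_pair_power le)+
  \<comment> \<open>A face lies at offset \<open>h / 2\<close>, whose square is three times the
    second moment \<open>h ^ 2 / 12\<close>.\<close>
  have quarter: "(dx C / 2)\<^sup>2 = 3 * A1" "(dy C / 2)\<^sup>2 = 3 * A2" "(dz C / 2)\<^sup>2 = 3 * A3"
    by (simp_all add: A1_def A2_def A3_def power_divide)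
  have face: "\<mu> / 2 * (e * x) + \<mu> / 2 * (e * y) = \<mu> * (e * z)" if "x + y = 2 * z"
    for \<mu> e x y z :: real
    using that by algebra
  have nodes: "(\<Sum>(w, v)\<leftarrow>internal D. w * separable (monom c a) (monom 1 b) (monom 1 d) v) =
    c * (2 * \<omega> * (X * Y * Z) + \<omega> * hx\<^sup>2 * (s * Y * Z) + \<omega> * hy\<^sup>2 * (X * t * Z) + \<omega> * hz\<^sup>2 * (X * Y * u))"
  proof -
    have "(\<Sum>(w, v)\<leftarrow>internal D. w * separable (monom c a) (monom 1 b) (monom 1 d) v) =
      c * \<omega> / 2 * (((xc C - hx) ^ a + (xc C + hx) ^ a) * Y * Z +
        X * ((yc C - hy) ^ b + (yc C + hy) ^ b) * Z +
        X * Y * ((zc C - hz) ^ d + (zc C + hz) ^ d) - 2 * (X * Y * Z))"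
      unfolding int by (simp add: poly_monom X_def Y_def Z_def algebra_simps)
    also have "\<dots> = c * (2 * \<omega> * (X * Y * Z) + \<omega> * hx\<^sup>2 * (s * Y * Z) + \<omega> * hy\<^sup>2 * (X * t * Z) +
        \<omega> * hz\<^sup>2 * (X * Y * u))"
      unfolding pair by (simp add: algebra_simps)
    finally show ?thesis .
  qed
  have "decomp_value C G D (separable (monom c a) (monom 1 b) (monom 1 d)) =
    c * (\<mu>1 * ((X + 3 * A1 * s) * (Y + A2 * t) * (Z + A3 * u)) +
      \<mu>2 * ((X + A1 * s) * (Y + 3 * A2 * t) * (Z + A3 * u)) +
      \<mu>3 * ((X + A1 * s) * (Y + A2 * t) * (Z + 3 * A3 * u)) +
      (2 * \<omega> * (X * Y * Z) + \<omega> * hx\<^sup>2 * (s * Y * Z) + \<omega> * hy\<^sup>2 * (X * t * Z) +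
        \<omega> * hz\<^sup>2 * (X * Y * u)))"
    unfolding decomp_value_separable[OF ex deg] m nodes w poly_monom pair[THEN face] quarter
    by (simp add: algebra_simps)
  \<comment> \<open>Coefficient of \<open>s * Y * Z\<close>: the faces give
    \<open>(3 * \<mu>1 + \<mu>2 + \<mu>3) * A1\<close> and the nodes
    \<open>2 * A1 * (\<omega> - \<mu>1)\<close>, together \<open>A1\<close> times the total weight.
    The other directions are analogous.\<close>
  also have "\<dots> = c * ((\<mu>1 + \<mu>2 + \<mu>3 + 2 * \<omega>) *
      (X * Y * Z + A1 * (s * Y * Z) + A2 * (X * t * Z) + A3 * (X * Y * u)))"
    unfolding prod3 h A1_def A2_def A3_def by (simp add: field_simps)
  also have "\<dots> = cell_average C (separable (monom c a) (monom 1 b) (monom 1 d))"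
    unfolding cell_average_separable m mult.assoc prod3[unfolded mult.assoc] sum1 by simp
  finally show "cell_average C (separable (monom c a) (monom 1 b) (monom 1 d)) =
    decomp_value C G D (separable (monom c a) (monom 1 b) (monom 1 d))" by simp
qed

section \<open>Upper bound for the CFL minimum\<close>

lemma separable_univariate_polys3:
  assumes "degree F \<le> k"
  shows "separable F 1 1 \<in> polys3 k" "separable 1 F 1 \<in> polys3 k" "separable 1 1 F \<in> polys3 k"
proof -
  have F: "poly F x = (\<Sum>a\<le>k. coeff F a * x ^ a)" for x
    unfolding poly_altdef using assms by (intro sum.mono_neutral_left) (auto simp: coeff_eq_0)
  show "separable F 1 1 \<in> polys3 k"
    unfolding polys3_def mem_Collect_eq
    by (rule exI[of _ "\<lambda>a b d. if b = 0 \<and> d = 0 then coeff F a else 0"])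
      (simp add: F sum.atMost_shift)
  show "separable 1 F 1 \<in> polys3 k"
    unfolding polys3_def mem_Collect_eq
    by (rule exI[of _ "\<lambda>a b d. if a = 0 \<and> d = 0 then coeff F b else 0"])
      (simp add: F sum.atMost_shift)
  show "separable 1 1 F \<in> polys3 k"
    unfolding polys3_def mem_Collect_eq
    by (rule exI[of _ "\<lambda>a b d. if a = 0 \<and> b = 0 then coeff F d else 0"])
      (simp add: F sum.atMost_shift)
qed

lemma sum_list_internal_nonneg:
  assumes "feasible k C G D" "\<And>v. 0 \<le> p v"
  shows "0 \<le> (\<Sum>(w, v)\<leftarrow>internal D. w * p v)"
  using assms unfolding feasible_def by (force intro!: sum_list_nonneg mult_nonneg_nonneg)

text \<open>The square \<open>(x - xc C) ^ 2\<close> equals \<open>3 * (dx C) ^ 2 / 12\<close> on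
  the two x faces and has mean \<open>(dx C) ^ 2 / 12\<close> on the other four, hence the factor 3
  in one direction only.\<close>

lemma feasible_weight_bounds:
  assumes "2 \<le> k" and pos: "0 < dx C" "0 < dy C" "0 < dz C"
    and ex: "gauss3_exact C G k" and feas: "feasible k C G D"
  shows "3 * (w1m D + w1p D) + (w2m D + w2p D) + (w3m D + w3p D) \<le> 1"
    and "(w1m D + w1p D) + 3 * (w2m D + w2p D) + (w3m D + w3p D) \<le> 1"
    and "(w1m D + w1p D) + (w2m D + w2p D) + 3 * (w3m D + w3p D) \<le> 1"
proof -
  define P :: "real \<Rightarrow> real poly" where "P c = [:- c, 1:]\<^sup>2" for c
  have P: "poly (P c) = (\<lambda>x. (x - c)\<^sup>2)" for c
    by (simp add: P_def fun_eq_iff)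
  have deg: "degree (P c) \<le> k" "degree (1 :: real poly) \<le> k" for c
    using \<open>2 \<le> k\<close> by (simp_all add: P_def degree_power_eq)
  note exact = feas[unfolded feasible_def, THEN conjunct1, rule_format, OF separable_univariate_polys3(1)[OF deg(1)]]
    feas[unfolded feasible_def, THEN conjunct1, rule_format, OF separable_univariate_polys3(2)[OF deg(1)]]
    feas[unfolded feasible_def, THEN conjunct1, rule_format, OF separable_univariate_polys3(3)[OF deg(1)]]
  have one: "poly 1 = (\<lambda>x :: real. 1 :: real)" by (simp add: fun_eq_iff)
  have m1: "mean c h (poly 1) = 1" if "0 < h" for c h
    using mean_one[OF that] by (simp add: one)
  have nonneg: "0 \<le> separable (P c) 1 1 v" "0 \<le> separable 1 (P c) 1 v" "0 \<le> separable 1 1 (P c) v" for c v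
    by (cases v; simp add: P)+
  have internal: "0 \<le> (\<Sum>(w, v)\<leftarrow>internal D. w * separable (P (xc C)) 1 1 v)"
    "0 \<le> (\<Sum>(w, v)\<leftarrow>internal D. w * separable 1 (P (yc C)) 1 v)"
    "0 \<le> (\<Sum>(w, v)\<leftarrow>internal D. w * separable 1 1 (P (zc C)) v)"
    by (rule sum_list_internal_nonneg[OF feas], rule nonneg)+
  \<comment> \<open>Here \<open>r\<close> stands for the combination of face weights and
    \<open>n\<close> for the contribution of the internal nodes.\<close>
  have cancel: "r \<le> 1" if "h\<^sup>2 / 12 = h\<^sup>2 / 12 * r + n" "0 \<le> n" "0 < h" for h r n :: real
  proof -
    have "h\<^sup>2 / 12 * r \<le> h\<^sup>2 / 12 * 1" using that by linarith
    then show ?thesis by (rule mult_left_le_imp_le) (use \<open>0 < h\<close> in simp)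
  qed
  note face_values = decomp_value_separable[OF ex] cell_average_separable
  show "3 * (w1m D + w1p D) + (w2m D + w2p D) + (w3m D + w3p D) \<le> 1"
    by (rule cancel[OF _ internal(1) pos(1)], use exact(1)[of "xc C"] in
      \<open>simp add: face_values deg m1 mean_centred_square pos P power_divide field_simps\<close>)
  show "(w1m D + w1p D) + 3 * (w2m D + w2p D) + (w3m D + w3p D) \<le> 1"
    by (rule cancel[OF _ internal(2) pos(2)], use exact(2)[of "yc C"] in
      \<open>simp add: face_values deg m1 mean_centred_square pos P power_divide field_simps\<close>)
  show "(w1m D + w1p D) + (w2m D + w2p D) + 3 * (w3m D + w3p D) \<le> 1"
    by (rule cancel[OF _ internal(3) pos(3)], use exact(3)[of "zc C"] in
      \<open>simp add: face_values deg m1 mean_centred_square pos P power_divide field_simps\<close>)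
qed

text \<open>The minimum \<open>m\<close> forces each face weight in direction \<open>r\<close> to be
  at least \<open>m * \<phi>r\<close>; inserting this into the weight bounds leaves a linear
  inequality for \<open>m\<close>. The bound holds for each choice of \<open>M\<close> and is
  sharpest for the largest.\<close>

lemma cfl_bound_le:
  assumes "2 \<le> k" and pos: "0 < dx C" "0 < dy C" "0 < dz C"
    and a: "0 < a1" "0 < a2" "0 < a3"
    and ex: "gauss3_exact C G k" and feas: "feasible k C G D"
    and M: "M \<in> {a1 / dx C, a2 / dy C, a3 / dz C}"
  shows "cfl_bound C a1 a2 a3 D \<le> 1 / (2 * (a1 / dx C + a2 / dy C + a3 / dz C + 2 * M))"
proof -
  define m where "m = cfl_bound C a1 a2 a3 D"
  define f1 where "f1 = a1 / dx C"
  define f2 where "f2 = a2 / dy C"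
  define f3 where "f3 = a3 / dz C"
  have f0: "0 < f1" "0 < f2" "0 < f3" using a pos by (simp_all add: f1_def f2_def f3_def)
  have M: "M = f1 \<or> M = f2 \<or> M = f3" using M by (simp add: f1_def f2_def f3_def)
  have "m \<le> w1m D * dx C / a1" "m \<le> w1p D * dx C / a1"
    "m \<le> w2m D * dy C / a2" "m \<le> w2p D * dy C / a2"
    "m \<le> w3m D * dz C / a3" "m \<le> w3p D * dz C / a3"
    unfolding m_def cfl_bound_def by (rule Min_le; simp)+
  then have "m * f1 \<le> w1m D" "m * f1 \<le> w1p D" "m * f2 \<le> w2m D" "m * f2 \<le> w2p D"
    "m * f3 \<le> w3m D" "m * f3 \<le> w3p D"
    using a pos by (simp_all add: f1_def f2_def f3_def field_simps)
  then have "2 * (m * f1) \<le> w1m D + w1p D" "2 * (m * f2) \<le> w2m D + w2p D"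
    "2 * (m * f3) \<le> w3m D + w3p D"
    by linarith+
  with feasible_weight_bounds[OF assms(1) pos ex feas]
  have "6 * (m * f1) + 2 * (m * f2) + 2 * (m * f3) \<le> 1"
    "2 * (m * f1) + 6 * (m * f2) + 2 * (m * f3) \<le> 1"
    "2 * (m * f1) + 2 * (m * f2) + 6 * (m * f3) \<le> 1"
    unfolding distrib_left by linarith+
  \<comment> \<open>Take the inequality whose coefficient 6 belongs to the direction of
    \<open>M\<close> and split that 6 as \<open>2 + 4\<close>.\<close>
  with M have "2 * (m * f1) + 2 * (m * f2) + 2 * (m * f3) + 4 * (m * M) \<le> 1"
    by (auto simp: algebra_simps)
  then have "m * (2 * (f1 + f2 + f3 + 2 * M)) \<le> 1"
    by (simp add: algebra_simps)
  moreover have "0 < 2 * (f1 + f2 + f3 + 2 * M)"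
    using M f0 by auto
  ultimately show ?thesis
    by (simp add: m_def f1_def f2_def f3_def pos_le_divide_eq)
qed

section \<open>Optimality of the displayed decomposition\<close>

text \<open>\<open>D\<close> takes the node list as argument because the three cases share all
  weights. If the maximum is attained more than once, each applicable list is shown to be
  optimal.\<close>

theorem theorem3:
  fixes k :: nat and C :: cell3 and G :: gauss3 and a1 a2 a3 :: real
    and \<phi>1 \<phi>2 \<phi>3 \<phi>max \<psi> \<mu>1 \<mu>2 \<mu>3 \<omega> hx hy hz :: real
    and D :: "point3 list \<Rightarrow> decomp3"
  assumes "k \<in> {2, 3}"
    and "0 < dx C" "0 < dy C" "0 < dz C"
    and "0 < a1" "0 < a2" "0 < a3"
    and "is_gauss3 C G" and "gauss3_exact C G k"
    and "\<phi>1 = a1 / dx C" "\<phi>2 = a2 / dy C" "\<phi>3 = a3 / dz C"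
    and "\<phi>max = Max {\<phi>1, \<phi>2, \<phi>3}"
    and "\<psi> = \<phi>1 + \<phi>2 + \<phi>3 + 2 * \<phi>max"
    and "\<mu>1 = \<phi>1 / \<psi>" "\<mu>2 = \<phi>2 / \<psi>" "\<mu>3 = \<phi>3 / \<psi>"
    and "\<omega> = \<phi>max / \<psi>"
    and "hx = dx C / sqrt 6 * sqrt ((\<phi>max - \<phi>1) / \<phi>max)"
    and "hy = dy C / sqrt 6 * sqrt ((\<phi>max - \<phi>2) / \<phi>max)"
    and "hz = dz C / sqrt 6 * sqrt ((\<phi>max - \<phi>3) / \<phi>max)"
    and "D = (\<lambda>nodes. \<lparr> w1m = \<mu>1 / 2, w1p = \<mu>1 / 2, w2m = \<mu>2 / 2, w2p = \<mu>2 / 2,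
           w3m = \<mu>3 / 2, w3p = \<mu>3 / 2, internal = map (\<lambda>v. (\<omega> / 2, v)) nodes \<rparr>)"
  shows "(\<phi>1 = \<phi>max \<longrightarrow> optimal k C G a1 a2 a3
            (D [(xc C, yc C - hy, zc C), (xc C, yc C + hy, zc C),
                (xc C, yc C, zc C - hz), (xc C, yc C, zc C + hz)])) \<and>
         (\<phi>2 = \<phi>max \<longrightarrow> optimal k C G a1 a2 a3
            (D [(xc C, yc C, zc C - hz), (xc C, yc C, zc C + hz),
                (xc C - hx, yc C, zc C), (xc C + hx, yc C, zc C)])) \<and>
         (\<phi>3 = \<phi>max \<longrightarrow> optimal k C G a1 a2 a3
            (D [(xc C - hx, yc C, zc C), (xc C + hx, yc C, zc C),
                (xc C, yc C - hy, zc C), (xc C, yc C + hy, zc C)]))"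
proof -
  have k: "k \<le> 3" "2 \<le> k" using assms(1) by auto
  note pos = assms(2-4) and a = assms(5-7) and ex = assms(9) and \<phi> = assms(10-12) and M = assms(13)
    and \<psi> = assms(14) and \<mu> = assms(15-17) and \<omega> = assms(18) and h = assms(19-21) and D = assms(22)
  have \<phi>0: "0 < \<phi>1" "0 < \<phi>2" "0 < \<phi>3" using pos a by (simp_all add: \<phi>)
  have le: "\<phi>1 \<le> \<phi>max" "\<phi>2 \<le> \<phi>max" "\<phi>3 \<le> \<phi>max" by (simp_all add: M)
  then have M0: "0 < \<phi>max" using \<phi>0 by linarith
  have \<psi>0: "0 < \<psi>" using \<phi>0 M0 by (simp add: \<psi>)
  have sum1: "\<mu>1 + \<mu>2 + \<mu>3 + 2 * \<omega> = 1"
    using \<psi>0 by (simp add: \<mu> \<omega> \<psi> flip: add_divide_distrib)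
  \<comment> \<open>The first equation is the moment condition needed for exactness. The second
    keeps the nodes in the cell: the root of the quotient is at most 1, and
    \<open>1 / 6 \<le> 1 / 4\<close>.\<close>
  have offset: "\<omega> * (e / sqrt 6 * sqrt ((\<phi>max - f) / \<phi>max))\<^sup>2 = e\<^sup>2 / 6 * (\<omega> - f / \<psi>)"
      "\<bar>e / sqrt 6 * sqrt ((\<phi>max - f) / \<phi>max)\<bar> \<le> e / 2"
    if "f \<le> \<phi>max" "0 < f" "0 < e" for e f
  proof -
    have sq: "(e / sqrt 6 * sqrt ((\<phi>max - f) / \<phi>max))\<^sup>2 = e\<^sup>2 / 6 * ((\<phi>max - f) / \<phi>max)"
      using that M0 by (simp add: power_mult_distrib power_divide)
    show "\<omega> * (e / sqrt 6 * sqrt ((\<phi>max - f) / \<phi>max))\<^sup>2 = e\<^sup>2 / 6 * (\<omega> - f / \<psi>)"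
      unfolding sq using M0 \<psi>0 by (simp add: \<omega> field_simps)
    have "(\<phi>max - f) / \<phi>max \<le> 1" using that M0 by simp
    then have "e\<^sup>2 / 6 * ((\<phi>max - f) / \<phi>max) \<le> e\<^sup>2 / 6 * 1"
      by (intro mult_left_mono) simp_all
    also have "\<dots> \<le> (e / 2)\<^sup>2" by (simp add: power_divide)
    finally have "(e / sqrt 6 * sqrt ((\<phi>max - f) / \<phi>max))\<^sup>2 \<le> (e / 2)\<^sup>2" unfolding sq .
    then show "\<bar>e / sqrt 6 * sqrt ((\<phi>max - f) / \<phi>max)\<bar> \<le> e / 2"
      using \<open>0 < e\<close> by (simp add: abs_le_square_iff[symmetric] del: abs_mult)
  qed
  have hsq: "\<omega> * hx\<^sup>2 = (dx C)\<^sup>2 / 6 * (\<omega> - \<mu>1)" "\<omega> * hy\<^sup>2 = (dy C)\<^sup>2 / 6 * (\<omega> - \<mu>2)"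
      "\<omega> * hz\<^sup>2 = (dz C)\<^sup>2 / 6 * (\<omega> - \<mu>3)"
    and hle: "\<bar>hx\<bar> \<le> dx C / 2" "\<bar>hy\<bar> \<le> dy C / 2" "\<bar>hz\<bar> \<le> dz C / 2"
    unfolding h \<mu> by (intro offset le \<phi>0 pos)+
  have weights: "w1m (D N) = \<mu>1 / 2" "w1p (D N) = \<mu>1 / 2" "w2m (D N) = \<mu>2 / 2"
    "w2p (D N) = \<mu>2 / 2" "w3m (D N) = \<mu>3 / 2" "w3p (D N) = \<mu>3 / 2"
    "internal (D N) = map (\<lambda>v. (\<omega> / 2, v)) N" for N
    by (simp_all add: D)
  \<comment> \<open>Since \<open>\<mu>r\<close> is \<open>\<phi>r / \<psi>\<close>, speeds and side
    lengths cancel, and the six ratios coincide whatever the internal nodes are.\<close>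
  have cfl: "cfl_bound C a1 a2 a3 (D N) = 1 / (2 * \<psi>)" for N
  proof -
    have "\<mu>1 / 2 * dx C / a1 = 1 / (2 * \<psi>)" "\<mu>2 / 2 * dy C / a2 = 1 / (2 * \<psi>)"
      "\<mu>3 / 2 * dz C / a3 = 1 / (2 * \<psi>)"
      using pos a by (simp_all add: \<mu> \<phi>)
    then show ?thesis by (simp only: cfl_bound_def weights insert_absorb2 Min_singleton)
  qed
  have max: "\<phi>max \<in> {a1 / dx C, a2 / dy C, a3 / dz C}"
    using Max_in[of "{\<phi>1, \<phi>2, \<phi>3}"] by (simp add: M \<phi>)
  have optimalI: "optimal k C G a1 a2 a3 (D N)"
    if int: "\<And>p :: point3 \<Rightarrow> real. (\<Sum>v\<leftarrow>N. p v) =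
      p (xc C - hx, yc C, zc C) + p (xc C + hx, yc C, zc C) +
      p (xc C, yc C - hy, zc C) + p (xc C, yc C + hy, zc C) +
      p (xc C, yc C, zc C - hz) + p (xc C, yc C, zc C + hz) - 2 * p (xc C, yc C, zc C)"
    and N: "set N \<subseteq> cell_set C" for N
  proof -
    have int': "(\<Sum>(w, v)\<leftarrow>internal (D N). w * p v) = \<omega> / 2 *
      (p (xc C - hx, yc C, zc C) + p (xc C + hx, yc C, zc C) +
       p (xc C, yc C - hy, zc C) + p (xc C, yc C + hy, zc C) +
       p (xc C, yc C, zc C - hz) + p (xc C, yc C, zc C + hz) - 2 * p (xc C, yc C, zc C))"
      for p :: "point3 \<Rightarrow> real"
      unfolding int[symmetric] by (simp only: weights map_map comp_def case_prod_conv sum_list_const_mult)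
    have "feasible k C G (D N)"
      unfolding feasible_def
    proof (intro conjI ballI)
      show "cell_average C p = decomp_value C G (D N) p" if "p \<in> polys3 k" for p
        using cell_average_eq_decomp_value[OF k(1) pos ex weights(1-6) sum1 hsq int' that] .
      \<comment> \<open>For the constant 1 the bracket in \<open>int'\<close> is
        \<open>6 - 2 = 4\<close>, so the internal weights add up to
        \<open>2 * \<omega>\<close>.\<close>
      show "w1m (D N) + w1p (D N) + w2m (D N) + w2p (D N) + w3m (D N) + w3p (D N)
          + (\<Sum>(w, v)\<leftarrow>internal (D N). w) = 1"
        using int'[of "\<lambda>v. 1"] sum1 by (simp add: weights)
    qed (use N \<psi>0 \<phi>0 M0 in \<open>auto simp: weights \<mu> \<omega>\<close>)
    moreover have "cfl_bound C a1 a2 a3 D' \<le> 1 / (2 * \<psi>)" if "feasible k C G D'" for D'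
      using cfl_bound_le[OF k(2) pos a ex that max] by (simp only: \<psi> \<phi>)
    ultimately show ?thesis unfolding optimal_def cfl by blast
  qed
  have in_cell: "(xc C - hx, yc C, zc C) \<in> cell_set C" "(xc C + hx, yc C, zc C) \<in> cell_set C"
    "(xc C, yc C - hy, zc C) \<in> cell_set C" "(xc C, yc C + hy, zc C) \<in> cell_set C"
    "(xc C, yc C, zc C - hz) \<in> cell_set C" "(xc C, yc C, zc C + hz) \<in> cell_set C"
    using hle pos unfolding cell_set_def cbox_Pair_eq by (auto simp: abs_le_iff)
  show ?thesis
  proof (intro conjI impI)
    assume "\<phi>1 = \<phi>max"
    \<comment> \<open>The x pair collapses to the centre and cancels against
      \<open>- 2 * p (xc C, yc C, zc C)\<close>, leaving the four listed nodes. The other two cases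
      work alike.\<close>
    then have "hx = 0" by (simp add: h)
    then show "optimal k C G a1 a2 a3
            (D [(xc C, yc C - hy, zc C), (xc C, yc C + hy, zc C),
                (xc C, yc C, zc C - hz), (xc C, yc C, zc C + hz)])"
      using in_cell by (intro optimalI) simp_all
  next
    assume "\<phi>2 = \<phi>max"
    then have "hy = 0" by (simp add: h)
    then show "optimal k C G a1 a2 a3
            (D [(xc C, yc C, zc C - hz), (xc C, yc C, zc C + hz),
                (xc C - hx, yc C, zc C), (xc C + hx, yc C, zc C)])"
      using in_cell by (intro optimalI) simp_all
  next
    assume "\<phi>3 = \<phi>max"
    then have "hz = 0" by (simp add: h)
    then show "optimal k C G a1 a2 a3
            (D [(xc C - hx, yc C, zc C), (xc C + hx, yc C, zc C),
                (xc C, yc C - hy, zc C), (xc C, yc C + hy, zc C)])"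
      using in_cell by (intro optimalI) simp_all
  qed
qed

end
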